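(* The $C^*$-dynamical system $(\mathfrak R_m,\alpha)$ consisting of the Monotone $C^*$-algebra and the shift is not uniquely ergodic with respect to the fixed point subalgebra.
   Context: For $k\ge1$ let $I_k=\{(i_1,\dots,i_k)\in\mathbb Z^k\mid i_1<\cdots<i_k\}$, and $I_0=\{\emptyset\}$. The Monotone Fock space is $\mathcal F_m=\bigoplus_{k\ge0}\ell^2(I_k)$, with canonical orthonormal basis $e_{(i_1,\dots,i_k)}$ and vacuum $\Omega=e_\emptyset$. For $i\in\mathbb Z$, the creation operator is $a_i^\dagger e_{(i_1,\dots,i_k)}=e_{(i,i_1,\dots,i_k)}$ if $i<i_1$ and $0$ otherwise, with $a_i^\dagger\Omega=e_{(i)}$; the annihilation operator is $a_ie_{(i_1,\dots,i_k)}=e_{(i_2,\dots,i_k)}$ if $k\ge1$ and $i=i_1$, and $0$ otherwise. They are bounded and mutually adjoint. $\mathfrak R_m$ is the unital $C^*$-algebra on $\mathcal F_m$ generated by $\{a_i\mid i\in\mathbb Z\}$. The shift is the automorphism $\alpha$ of $\mathfrak R_m$ with $\alpha(a_i)=a_{i+1}$, implemented by the unitary $e_{(i_1,\dots,i_k)}\mapsto e_{(i_1+1,\dots,i_k+1)}$, $\Omega\mapsto\Omega$. For a unital $C^*$-algebra $\mathfrak A$ and an automorphism $\alpha$, the fixed point subalgebra is $\mathfrak A^{\mathbb Z}=\{a\in\mathfrak A\mid\alpha(a)=a\}$. The system $(\mathfrak A,\alpha)$ is uniquely ergodic with respect to the fixed point subalgebra if there is an $\alpha$-invariant conditional expectation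 $E^{\mathbb Z}:\mathfrak A\to\mathfrak A^{\mathbb Z}$ such that $\lim_{n\to+\infty}\frac1n\sum_{k=0}^{n-1}f(\alpha^k(a))=f(E^{\mathbb Z}(a))$ for all $a\in\mathfrak A$, $f\in\mathfrak A^*$. *)

theory Defs
  imports "HOL-Analysis.Analysis"
begin

section \<open>The complex Hilbert space of square-summable functions\<close>

typedef 'i ell2 = "{f :: 'i \<Rightarrow> complex. (\<lambda>x. (cmod (f x))\<^sup>2) summable_on UNIV}"
  morphisms coord Abs_ell2
  by (rule exI[of _ "\<lambda>_. 0"]) simp

setup_lifting type_definition_ell2

lemma coord_square_summable: "(\<lambda>x. (cmod (coord f x))\<^sup>2) summable_on UNIV"
  using coord by auto

lemma ell2_eqI: "(\<And>x. coord f x = coord g x) \<Longrightarrow> f = g"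
  by (simp add: coord_inject[symmetric] fun_eq_iff)

lemma mult_summable_of_square_summable:
  fixes f g :: "'i \<Rightarrow> complex"
  assumes "(\<lambda>x. (cmod (f x))\<^sup>2) summable_on A" "(\<lambda>x. (cmod (g x))\<^sup>2) summable_on A"
  shows "(\<lambda>x. cnj (f x) * g x) summable_on A"
proof -
  have "(\<lambda>x. (cmod (f x))\<^sup>2 + (cmod (g x))\<^sup>2) summable_on A"
    by (intro summable_on_add assms)
  moreover have "cmod (cnj (f x) * g x) \<le> (cmod (f x))\<^sup>2 + (cmod (g x))\<^sup>2" for x
    using sum_squares_bound[of "cmod (f x)" "cmod (g x)"]
      mult_nonneg_nonneg[OF norm_ge_zero norm_ge_zero, of "f x" "g x"]
    unfolding norm_mult complex_mod_cnj by linarith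
  ultimately have "(\<lambda>x. cmod (cnj (f x) * g x)) summable_on A"
    by (rule Infinite_Sum.abs_summable_on_comparison_test')
  then show ?thesis by (rule abs_summable_summable)
qed

lemma add_square_summable:
  fixes f g :: "'i \<Rightarrow> complex"
  assumes "(\<lambda>x. (cmod (f x))\<^sup>2) summable_on A" "(\<lambda>x. (cmod (g x))\<^sup>2) summable_on A"
  shows "(\<lambda>x. (cmod (f x + g x))\<^sup>2) summable_on A"
proof (rule summable_on_comparison_test)
  show "(\<lambda>x. 2 * (cmod (f x))\<^sup>2 + 2 * (cmod (g x))\<^sup>2) summable_on A"
    by (intro summable_on_add summable_on_cmult_right assms)
  show "(cmod (f x + g x))\<^sup>2 \<le> 2 * (cmod (f x))\<^sup>2 + 2 * (cmod (g x))\<^sup>2" for x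
  proof -
    have "(cmod (f x + g x))\<^sup>2 \<le> (cmod (f x) + cmod (g x))\<^sup>2"
      by (simp add: norm_triangle_ineq power_mono)
    also have "\<dots> \<le> 2 * (cmod (f x))\<^sup>2 + 2 * (cmod (g x))\<^sup>2"
      using sum_squares_bound[of "cmod (f x)" "cmod (g x)"] by (simp add: power2_sum)
    finally show ?thesis .
  qed
qed simp

lemma scale_square_summable:
  fixes f :: "'i \<Rightarrow> complex"
  assumes "(\<lambda>x. (cmod (f x))\<^sup>2) summable_on A"
  shows "(\<lambda>x. (cmod (c * f x))\<^sup>2) summable_on A"
  using summable_on_cmult_right[OF assms, of "(cmod c)\<^sup>2"]
  by (simp add: norm_mult power_mult_distrib)

lift_definition scaleC :: "complex \<Rightarrow> 'i ell2 \<Rightarrow> 'i ell2" is "\<lambda>c f x. c * f x"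
  by (rule scale_square_summable)

lift_definition cinner :: "'i ell2 \<Rightarrow> 'i ell2 \<Rightarrow> complex"
  is "\<lambda>f g. \<Sum>\<^sub>\<infinity>x. cnj (f x) * g x" .

instantiation ell2 :: (type) real_vector
begin

lift_definition zero_ell2 :: "'a ell2" is "\<lambda>_. 0" by simp
lift_definition plus_ell2 :: "'a ell2 \<Rightarrow> 'a ell2 \<Rightarrow> 'a ell2" is "\<lambda>f g x. f x + g x"
  by (rule add_square_summable)
lift_definition uminus_ell2 :: "'a ell2 \<Rightarrow> 'a ell2" is "\<lambda>f x. - f x" by simp
lift_definition minus_ell2 :: "'a ell2 \<Rightarrow> 'a ell2 \<Rightarrow> 'a ell2" is "\<lambda>f g x. f x - g x"
  using add_square_summable[where g = "\<lambda>x. - g x" for g] by simp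
lift_definition scaleR_ell2 :: "real \<Rightarrow> 'a ell2 \<Rightarrow> 'a ell2" is "\<lambda>r f x. of_real r * f x"
  by (rule scale_square_summable)

instance
proof
  fix f g h :: "'a ell2" and r s :: real
  show "f + g + h = f + (g + h)" by transfer (simp add: add.assoc)
  show "f + g = g + f" by transfer (simp add: add.commute)
  show "0 + f = f" by transfer simp
  show "- f + f = 0" by transfer simp
  show "f - g = f + - g" by transfer simp
  show "r *\<^sub>R (f + g) = r *\<^sub>R f + r *\<^sub>R g" by transfer (simp add: algebra_simps)
  show "(r + s) *\<^sub>R f = r *\<^sub>R f + s *\<^sub>R f" by transfer (simp add: algebra_simps)
  show "r *\<^sub>R s *\<^sub>R f = (r * s) *\<^sub>R f" by transfer (simp add: algebra_simps)
  show "1 *\<^sub>R f = f" by transfer simp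
qed

end

instantiation ell2 :: (type) real_inner
begin

definition inner_ell2 :: "'a ell2 \<Rightarrow> 'a ell2 \<Rightarrow> real" where
  "inner_ell2 f g = Re (cinner f g)"
definition norm_ell2 :: "'a ell2 \<Rightarrow> real" where
  "norm_ell2 f = sqrt (\<Sum>\<^sub>\<infinity>x. (cmod (coord f x))\<^sup>2)"
definition dist_ell2 :: "'a ell2 \<Rightarrow> 'a ell2 \<Rightarrow> real" where
  "dist_ell2 f g = norm (f - g)"
definition sgn_ell2 :: "'a ell2 \<Rightarrow> 'a ell2" where
  "sgn_ell2 f = f /\<^sub>R norm f"
definition uniformity_ell2 :: "('a ell2 \<times> 'a ell2) filter" where
  "uniformity_ell2 = (INF e\<in>{0<..}. principal {(x, y). dist x y < e})"
definition open_ell2 :: "'a ell2 set \<Rightarrow> bool" where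
  "open_ell2 U = (\<forall>x\<in>U. \<forall>\<^sub>F (x', y) in uniformity. x' = x \<longrightarrow> y \<in> U)"

instance
proof
  fix f g h :: "'a ell2" and r :: real and U :: "'a ell2 set"
  show "sgn f = f /\<^sub>R norm f" by (rule sgn_ell2_def)
  show "dist f g = norm (f - g)" by (rule dist_ell2_def)
  show "uniformity = (INF e\<in>{0<..}. principal {(x :: 'a ell2, y). dist x y < e})"
    by (rule uniformity_ell2_def)
  show "open U = (\<forall>x\<in>U. \<forall>\<^sub>F (x', y) in uniformity. x' = x \<longrightarrow> y \<in> U)"
    by (rule open_ell2_def)
  have cinner: "cinner u v = (\<Sum>\<^sub>\<infinity>x. cnj (coord u x) * coord v x)" for u v :: "'a ell2"
    by (rule cinner.rep_eq)
  have sm: "(\<lambda>x. cnj (coord u x) * coord v x) summable_on UNIV" for u v :: "'a ell2"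
    by (intro mult_summable_of_square_summable coord_square_summable)
  have "cinner f g = cnj (cinner g f)"
    by (simp add: cinner infsum_cnj[symmetric] mult.commute)
  then show "inner f g = inner g f" by (simp add: inner_ell2_def)
  show "inner (f + g) h = inner f h + inner g h"
    by (simp add: inner_ell2_def cinner plus_ell2.rep_eq distrib_right infsum_add sm)
  have "cinner (r *\<^sub>R f) g = of_real r * cinner f g"
    by (simp add: cinner scaleR_ell2.rep_eq mult.assoc infsum_cmult_right')
  then show "inner (r *\<^sub>R f) g = r * inner f g" by (simp add: inner_ell2_def)
  have sq: "inner f f = (\<Sum>\<^sub>\<infinity>x. (cmod (coord f x))\<^sup>2)"
  proof -
    have "Re (cnj z * z) = (cmod z)\<^sup>2" for z
      by (simp add: cmod_power2) (simp add: power2_eq_square)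
    then show ?thesis
      by (simp add: inner_ell2_def cinner infsum_Re[OF sm, symmetric])
  qed
  show "0 \<le> inner f f" by (simp add: sq infsum_nonneg)
  show "inner f f = 0 \<longleftrightarrow> f = 0"
  proof
    assume "inner f f = 0"
    then have "(cmod (coord f x))\<^sup>2 = 0" for x
      by (intro nonneg_infsum_le_0D[OF _ coord_square_summable]) (simp_all add: sq)
    then show "f = 0" by (intro ell2_eqI) (simp add: zero_ell2.rep_eq)
  qed (simp add: inner_ell2_def cinner zero_ell2.rep_eq)
  show "norm f = sqrt (inner f f)" by (simp add: norm_ell2_def sq)
qed

end

lift_definition ket :: "'i \<Rightarrow> 'i ell2" is "\<lambda>y x. if x = y then 1 else 0"
proof -
  fix y :: 'i
  have "(\<lambda>x. (cmod (if x = y then 1 else 0))\<^sup>2) summable_on {y}" by simp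
  then show "(\<lambda>x. (cmod (if x = y then 1 else 0))\<^sup>2) summable_on UNIV"
    by (rule summable_on_cong_neutral[THEN iffD1, rotated -1]) auto
qed

lemma norm_scaleC: "norm (scaleC c f) = cmod c * norm f"
  by (simp add: norm_ell2_def scaleC.rep_eq norm_mult power_mult_distrib infsum_cmult_right'
      real_sqrt_mult)

lemma scaleC_add_right: "scaleC c (f + g) = scaleC c f + scaleC c g"
  by transfer (simp add: algebra_simps)

lemma scaleC_scaleR: "scaleC c (r *\<^sub>R f) = r *\<^sub>R scaleC c f"
  by transfer (simp add: algebra_simps)

lemma bounded_linear_scaleC: "bounded_linear (scaleC c)"
  by (rule bounded_linear_intro[where K = "cmod c"])
    (simp_all add: scaleC_add_right scaleC_scaleR norm_scaleC mult.commute)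


section \<open>Concrete operator algebras\<close>

text \<open>
  Bounded operators are elements of \<open>'i ell2 \<Rightarrow>\<^sub>L 'i ell2\<close>, with the operator norm and its
  topology.  This type only enforces real linearity, so complex linearity is a separate predicate.
\<close>

type_synonym 'i op = "'i ell2 \<Rightarrow>\<^sub>L 'i ell2"

definition complex_linear_op :: "'i op \<Rightarrow> bool" where
  "complex_linear_op T \<longleftrightarrow> (\<forall>c f. blinfun_apply T (scaleC c f) = scaleC c (blinfun_apply T f))"

definition is_adjoint :: "'i op \<Rightarrow> 'i op \<Rightarrow> bool" where
  "is_adjoint S T \<longleftrightarrow>
     (\<forall>f g. cinner (blinfun_apply S f) g = cinner f (blinfun_apply T g))"

definition scaleC_op :: "complex \<Rightarrow> 'i op \<Rightarrow> 'i op" where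
  "scaleC_op c T = Blinfun (scaleC c) o\<^sub>L T"

lemma scaleC_op_apply: "blinfun_apply (scaleC_op c T) f = scaleC c (blinfun_apply T f)"
  by (simp add: scaleC_op_def bounded_linear_Blinfun_apply[OF bounded_linear_scaleC])

definition unital_cstar_algebra :: "'i op set \<Rightarrow> bool" where
  "unital_cstar_algebra A \<longleftrightarrow>
     (\<forall>T\<in>A. complex_linear_op T) \<and>
     id_blinfun \<in> A \<and>
     (\<forall>S\<in>A. \<forall>T\<in>A. S + T \<in> A) \<and>
     (\<forall>c. \<forall>T\<in>A. scaleC_op c T \<in> A) \<and>
     (\<forall>S\<in>A. \<forall>T\<in>A. S o\<^sub>L T \<in> A) \<and>
     (\<forall>T\<in>A. \<exists>S\<in>A. is_adjoint S T) \<and>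
     closed A"

definition generated_unital_cstar_algebra :: "'i op set \<Rightarrow> 'i op set" where
  "generated_unital_cstar_algebra G = \<Inter> {A. unital_cstar_algebra A \<and> G \<subseteq> A}"

text \<open>The elements \<open>T\<^sup>* T\<close> with \<open>T \<in> A\<close>.\<close>

definition positive_elements :: "'i op set \<Rightarrow> 'i op set" where
  "positive_elements A = {S o\<^sub>L T | S T. S \<in> A \<and> T \<in> A \<and> is_adjoint S T}"

definition linear_on_algebra :: "'i op set \<Rightarrow> ('i op \<Rightarrow> 'i op) \<Rightarrow> bool" where
  "linear_on_algebra A E \<longleftrightarrow>
     (\<forall>S\<in>A. \<forall>T\<in>A. E (S + T) = E S + E T) \<and>
     (\<forall>c. \<forall>T\<in>A. E (scaleC_op c T) = scaleC_op c (E T))"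

definition conditional_expectation ::
    "'i op set \<Rightarrow> 'i op set \<Rightarrow> ('i op \<Rightarrow> 'i op) \<Rightarrow> bool" where
  "conditional_expectation A B E \<longleftrightarrow>
     linear_on_algebra A E \<and>
     (\<forall>T\<in>A. E T \<in> B) \<and>
     (\<forall>T\<in>B. E T = T) \<and>
     (\<forall>T\<in>positive_elements A. E T \<in> positive_elements B) \<and>
     (\<forall>S\<in>B. \<forall>T\<in>A. E (S o\<^sub>L T) = S o\<^sub>L E T \<and> E (T o\<^sub>L S) = E T o\<^sub>L S)"

definition bounded_functional :: "'i op set \<Rightarrow> ('i op \<Rightarrow> complex) \<Rightarrow> bool" where
  "bounded_functional A \<phi> \<longleftrightarrow>
     (\<forall>S\<in>A. \<forall>T\<in>A. \<phi> (S + T) = \<phi> S + \<phi> T) \<and>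
     (\<forall>c. \<forall>T\<in>A. \<phi> (scaleC_op c T) = c * \<phi> T) \<and>
     (\<exists>K. \<forall>T\<in>A. cmod (\<phi> T) \<le> K * norm T)"

definition fixed_point_subalgebra :: "'i op set \<Rightarrow> ('i op \<Rightarrow> 'i op) \<Rightarrow> 'i op set" where
  "fixed_point_subalgebra A \<alpha> = {T \<in> A. \<alpha> T = T}"

definition uniquely_ergodic_wrt_fixed_points :: "'i op set \<Rightarrow> ('i op \<Rightarrow> 'i op) \<Rightarrow> bool" where
  "uniquely_ergodic_wrt_fixed_points A \<alpha> \<longleftrightarrow>
     (\<exists>E. conditional_expectation A (fixed_point_subalgebra A \<alpha>) E \<and>
          (\<forall>T\<in>A. E (\<alpha> T) = E T) \<and>
          (\<forall>T\<in>A. \<forall>\<phi>. bounded_functional A \<phi> \<longrightarrow>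
             (\<lambda>n. (\<Sum>k<n. \<phi> ((\<alpha> ^^ k) T)) / of_nat n) \<longlonglongrightarrow> \<phi> (E T)))"


section \<open>The monotone Fock space\<close>

text \<open>
  All the index sets \<open>I\<^sub>k\<close> are collected in one type of strictly increasing lists, so that the
  direct sum of the spaces over the \<open>I\<^sub>k\<close> is \<open>mono_index ell2\<close>.
\<close>

typedef mono_index = "{xs :: int list. sorted_wrt (<) xs}"
  by (rule exI[of _ "[]"]) simp

setup_lifting type_definition_mono_index

lift_definition empty_index :: mono_index is "[]" by simp

lift_definition precedes :: "int \<Rightarrow> mono_index \<Rightarrow> bool"
  is "\<lambda>i xs. case xs of [] \<Rightarrow> True | j # _ \<Rightarrow> i < j" .

lift_definition starts_with :: "int \<Rightarrow> mono_index \<Rightarrow> bool"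
  is "\<lambda>i xs. case xs of [] \<Rightarrow> False | j # _ \<Rightarrow> i = j" .

text \<open>Only relevant for \<open>precedes i x\<close>; otherwise \<open>x\<close> is returned unchanged.\<close>

lift_definition prepend :: "int \<Rightarrow> mono_index \<Rightarrow> mono_index"
  is "\<lambda>i xs. if (case xs of [] \<Rightarrow> True | j # _ \<Rightarrow> i < j) then i # xs else xs"
  by (force split: list.splits)

lift_definition tail_index :: "mono_index \<Rightarrow> mono_index" is tl
  by (metis list.exhaust_sel list.sel(2) sorted_wrt.simps(2))

lift_definition translate_index :: "int \<Rightarrow> mono_index \<Rightarrow> mono_index"
  is "\<lambda>n. map (\<lambda>j. j + n)"
  by (simp add: sorted_wrt_map)

lemma tail_prepend: "precedes i x \<Longrightarrow> tail_index (prepend i x) = x"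
  by transfer simp

lemma starts_with_prepend: "precedes i x \<Longrightarrow> starts_with i (prepend i x)"
  by transfer simp

lemma precedes_tail: "starts_with i x \<Longrightarrow> precedes i (tail_index x)"
  by transfer (auto split: list.splits)

lemma prepend_tail: "starts_with i x \<Longrightarrow> prepend i (tail_index x) = x"
  by transfer (auto split: list.splits)

lemma translate_translate [simp]:
  "translate_index m (translate_index n x) = translate_index (n + m) x"
  by transfer (simp add: o_def add.assoc)

lemma translate_zero [simp]: "translate_index 0 x = x"
  by transfer simp

lemma precedes_translate: "precedes i (translate_index n x) \<longleftrightarrow> precedes (i - n) x"
  by transfer (auto split: list.splits)

lemma prepend_translate:
  "prepend i (translate_index n x) = translate_index n (prepend (i - n) x)"
  by transfer (auto split: list.splits)

type_synonym mono_fock = "mono_index ell2"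

lemma
  fixes f :: "'i \<Rightarrow> complex" and p :: "'i \<Rightarrow> 'i"
  assumes p: "inj_on p {x. D x}" and f: "(\<lambda>x. (cmod (f x))\<^sup>2) summable_on UNIV"
  shows pullback_square_summable: "(\<lambda>x. (cmod (if D x then f (p x) else 0))\<^sup>2) summable_on UNIV"
    and pullback_norm_le: "(\<Sum>\<^sub>\<infinity>x. (cmod (if D x then f (p x) else 0))\<^sup>2) \<le> (\<Sum>\<^sub>\<infinity>x. (cmod (f x))\<^sup>2)"
proof -
  let ?g = "\<lambda>x. (cmod (f x))\<^sup>2" and ?h = "\<lambda>x. (cmod (if D x then f (p x) else 0))\<^sup>2"
  have "?g summable_on p ` {x. D x}"
    using f by (rule summable_on_subset_banach) simp
  then have "(?g \<circ> p) summable_on {x. D x}"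
    by (simp add: summable_on_reindex[OF p])
  then show "?h summable_on UNIV"
    by (rule summable_on_cong_neutral[THEN iffD1, rotated -1]) auto
  have "infsum ?h UNIV = infsum (?g \<circ> p) {x. D x}"
    by (rule infsum_cong_neutral) auto
  also have "\<dots> = infsum ?g (p ` {x. D x})"
    by (rule infsum_reindex[OF p, symmetric])
  also have "\<dots> \<le> infsum ?g UNIV"
    using \<open>?g summable_on p ` {x. D x}\<close> f
    by (rule infsum_mono_neutral) auto
  finally show "infsum ?h UNIV \<le> infsum ?g UNIV" .
qed

lemma pullback_bounded_linear:
  fixes F :: "'i ell2 \<Rightarrow> 'i ell2"
  assumes "inj_on p {x. D x}"
    and F: "\<And>f x. coord (F f) x = (if D x then coord f (p x) else 0)"
  shows "bounded_linear F"
proof (rule bounded_linear_intro[where K = 1])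
  show "F (f + g) = F f + F g" for f g
    by (rule ell2_eqI) (simp add: F plus_ell2.rep_eq)
  show "F (r *\<^sub>R f) = r *\<^sub>R F f" for r f
    by (rule ell2_eqI) (simp add: F scaleR_ell2.rep_eq)
  show "norm (F f) \<le> norm f * 1" for f
    unfolding norm_ell2_def F
    by (simp add: pullback_norm_le[OF assms(1) coord_square_summable])
qed

lemma inj_prepend: "inj_on (prepend i) {x. precedes i x}"
  by (rule inj_onI) (metis mem_Collect_eq tail_prepend)

lemma inj_tail: "inj_on tail_index {x. starts_with i x}"
  by (rule inj_onI) (metis mem_Collect_eq prepend_tail)

lemma inj_translate: "inj (translate_index n)"
  by (rule inj_on_inverseI[where g = "translate_index (- n)"]) simp

lift_definition annihilate :: "int \<Rightarrow> mono_fock \<Rightarrow> mono_fock"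
  is "\<lambda>i f x. if precedes i x then f (prepend i x) else 0"
  by (rule pullback_square_summable[OF inj_prepend])

lift_definition create :: "int \<Rightarrow> mono_fock \<Rightarrow> mono_fock"
  is "\<lambda>i f x. if starts_with i x then f (tail_index x) else 0"
  by (rule pullback_square_summable[OF inj_tail])

lift_definition translate :: "int \<Rightarrow> mono_fock \<Rightarrow> mono_fock"
  is "\<lambda>n f x. f (translate_index (- n) x)"
proof -
  fix n and f :: "mono_index \<Rightarrow> complex"
  assume f: "(\<lambda>x. (cmod (f x))\<^sup>2) summable_on UNIV"
  have "inj_on (translate_index (- n)) {x. True}" by (simp add: inj_translate)
  from pullback_square_summable[OF this f]
  show "(\<lambda>x. (cmod (f (translate_index (- n) x)))\<^sup>2) summable_on UNIV" by simp
qed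

definition annihilation :: "int \<Rightarrow> mono_index op" where
  "annihilation i = Blinfun (annihilate i)"

definition creation :: "int \<Rightarrow> mono_index op" where
  "creation i = Blinfun (create i)"

definition translation :: "int \<Rightarrow> mono_index op" where
  "translation n = Blinfun (translate n)"

lemma coord_annihilation:
  "coord (blinfun_apply (annihilation i) f) x = (if precedes i x then coord f (prepend i x) else 0)"
proof -
  have "bounded_linear (annihilate i)"
    by (rule pullback_bounded_linear[OF inj_prepend]) (simp add: annihilate.rep_eq)
  then show ?thesis
    by (simp add: annihilation_def bounded_linear_Blinfun_apply annihilate.rep_eq)
qed

lemma coord_creation:
  "coord (blinfun_apply (creation i) f) x = (if starts_with i x then coord f (tail_index x) else 0)"
proof -
  have "bounded_linear (create i)"
    by (rule pullback_bounded_linear[OF inj_tail]) (simp add: create.rep_eq)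
  then show ?thesis
    by (simp add: creation_def bounded_linear_Blinfun_apply create.rep_eq)
qed

lemma coord_translation:
  "coord (blinfun_apply (translation n) f) x = coord f (translate_index (- n) x)"
proof -
  have "inj_on (translate_index (- n)) {x. True}" by (simp add: inj_translate)
  then have "bounded_linear (translate n)"
    by (rule pullback_bounded_linear) (simp add: translate.rep_eq)
  then show ?thesis
    by (simp add: translation_def bounded_linear_Blinfun_apply translate.rep_eq)
qed

lemma creation_ket:
  "blinfun_apply (creation i) (ket x) = (if precedes i x then ket (prepend i x) else 0)"
proof (rule ell2_eqI)
  fix y
  have "starts_with i y \<and> tail_index y = x \<longleftrightarrow> precedes i x \<and> y = prepend i x"
    by (metis precedes_tail prepend_tail starts_with_prepend tail_prepend)
  then show "coord (blinfun_apply (creation i) (ket x)) y =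
      coord (if precedes i x then ket (prepend i x) else 0) y"
    by (auto simp: coord_creation ket.rep_eq zero_ell2.rep_eq)
qed

lemma annihilation_ket:
  "blinfun_apply (annihilation i) (ket x) = (if starts_with i x then ket (tail_index x) else 0)"
proof (rule ell2_eqI)
  fix y
  have "precedes i y \<and> prepend i y = x \<longleftrightarrow> starts_with i x \<and> y = tail_index x"
    by (metis precedes_tail prepend_tail starts_with_prepend tail_prepend)
  then show "coord (blinfun_apply (annihilation i) (ket x)) y =
      coord (if starts_with i x then ket (tail_index x) else 0) y"
    by (auto simp: coord_annihilation ket.rep_eq zero_ell2.rep_eq)
qed

lemma translation_ket: "blinfun_apply (translation n) (ket x) = ket (translate_index n x)"
proof (rule ell2_eqI)
  fix y
  have "translate_index (- n) y = x \<longleftrightarrow> y = translate_index n x" by auto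
  then show "coord (blinfun_apply (translation n) (ket x)) y = coord (ket (translate_index n x)) y"
    by (simp add: coord_translation ket.rep_eq)
qed

definition vacuum :: mono_fock where
  "vacuum = ket empty_index"

lemma vacuum_simps:
  "blinfun_apply (creation i) vacuum = ket (prepend i empty_index)"
  "blinfun_apply (annihilation i) vacuum = 0"
  "blinfun_apply (translation n) vacuum = vacuum"
proof -
  have "precedes i empty_index" "\<not> starts_with i empty_index"
    "translate_index n empty_index = empty_index"
    by (transfer; simp)+
  then show "blinfun_apply (creation i) vacuum = ket (prepend i empty_index)"
    "blinfun_apply (annihilation i) vacuum = 0"
    "blinfun_apply (translation n) vacuum = vacuum"
    by (simp_all add: vacuum_def creation_ket annihilation_ket translation_ket)
qed

lemma creation_adjoint: "is_adjoint (creation i) (annihilation i)"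
  unfolding is_adjoint_def
proof (intro allI)
  fix f g
  have "cinner (blinfun_apply (creation i) f) g =
      (\<Sum>\<^sub>\<infinity>x\<in>{x. starts_with i x}. cnj (coord f (tail_index x)) * coord g x)"
    unfolding cinner.rep_eq by (rule infsum_cong_neutral) (auto simp: coord_creation)
  also have "\<dots> = (\<Sum>\<^sub>\<infinity>x\<in>{x. precedes i x}. cnj (coord f x) * coord g (prepend i x))"
    by (rule infsum_reindex_bij_witness[where i = "prepend i" and j = tail_index])
      (auto simp: tail_prepend starts_with_prepend precedes_tail prepend_tail)
  also have "\<dots> = cinner f (blinfun_apply (annihilation i) g)"
    unfolding cinner.rep_eq by (rule infsum_cong_neutral) (auto simp: coord_annihilation)
  finally show "cinner (blinfun_apply (creation i) f) g = cinner f (blinfun_apply (annihilation i) g)" .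
qed

lemma translation_adjoint: "is_adjoint (translation (- n)) (translation n)"
  unfolding is_adjoint_def
proof (intro allI)
  fix f g
  show "cinner (blinfun_apply (translation (- n)) f) g = cinner f (blinfun_apply (translation n) g)"
    unfolding cinner.rep_eq coord_translation
    by (rule infsum_reindex_bij_witness[where i = "translate_index (- n)" and j = "translate_index n"])
      simp_all
qed

lemma translation_inverse: "translation n o\<^sub>L translation (- n) = id_blinfun"
  by (intro blinfun_eqI ell2_eqI) (simp add: coord_translation)

definition monotone_cstar_algebra :: "mono_index op set" where
  "monotone_cstar_algebra = generated_unital_cstar_algebra (range annihilation)"

definition monotone_shift :: "mono_index op \<Rightarrow> mono_index op" where
  "monotone_shift T = translation 1 o\<^sub>L T o\<^sub>L translation (- 1)"

lemma monotone_shift_annihilation: "monotone_shift (annihilation i) = annihilation (i + 1)"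
  by (intro blinfun_eqI ell2_eqI)
    (simp add: monotone_shift_def coord_translation coord_annihilation precedes_translate
      prepend_translate)

end

theory Submission
  imports Defs
begin

text \<open>
  The shift moves the projection \<open>P\<^sub>0 = a\<^sub>0a\<^sub>0\<^sup>\<dagger>\<close> to \<open>P\<^sub>k = a\<^sub>ka\<^sub>k\<^sup>\<dagger>\<close>, the projection onto the span of \<open>\<Omega>\<close> and
  of the basis vectors whose first index exceeds \<open>k\<close>.  Testing unique ergodicity on the diagonal
  functionals \<open>\<phi>\<^sub>j(T) = \<langle>e\<^sub>(\<^sub>j\<^sub>), T e\<^sub>(\<^sub>j\<^sub>)\<rangle>\<close> forces \<open>\<phi>\<^sub>j(E(P\<^sub>0)) = 0\<close> for all \<open>j\<close>, because
  \<open>\<phi>\<^sub>j(P\<^sub>k) = 0\<close> for \<open>k \<ge> j\<close>.  A weak-* cluster point \<open>\<psi>\<close> of the \<open>\<phi>\<^sub>j\<close> as \<open>j \<rightarrow> \<infinity>\<close> then also kills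
  \<open>E(P\<^sub>0)\<close>, although \<open>\<psi>(P\<^sub>k) = 1\<close> for every \<open>k\<close>, so that its ergodic averages are all 1.
\<close>

text \<open>Tychonoff: the sequence lives in a product of compact closures. Products over a large
  index type need not be sequentially compact, so \<psi> is a cluster point rather than the limit of
  a subsequence. It inherits every closed condition that holds eventually along the
  sequence.\<close>

lemma pointwise_bounded_cluster_point:
  fixes \<phi> :: "nat \<Rightarrow> 'a \<Rightarrow> 'b::heine_borel"
  assumes bounded: "\<And>x. bounded (range (\<lambda>n. \<phi> n x))"
  obtains \<psi> where "\<And>C. closed C \<Longrightarrow> \<forall>\<^sub>F n in sequentially. \<phi> n \<in> C \<Longrightarrow> \<psi> \<in> C"
proof -
  define P where "P = PiE UNIV (\<lambda>x. closure (range (\<lambda>n. \<phi> n x)))"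
  have "compactin (product_topology (\<lambda>_. euclidean) UNIV) P"
    unfolding P_def compactin_PiE using bounded by simp
  then have "compact P"
    by (simp add: euclidean_product_topology)
  moreover have "\<forall>\<^sub>F f in filtermap \<phi> sequentially. f \<in> P"
    by (simp add: eventually_filtermap P_def PiE_def extensional_def closure_subset[THEN subsetD])
  moreover have "filtermap \<phi> sequentially \<noteq> bot"
    by (simp add: filtermap_bot_iff)
  ultimately obtain \<psi> where \<psi>: "inf (nhds \<psi>) (filtermap \<phi> sequentially) \<noteq> bot"
    unfolding compact_filter by blast
  show ?thesis
  proof (rule that, rule ccontr)
    fix C assume C: "closed C" "\<forall>\<^sub>F n in sequentially. \<phi> n \<in> C" "\<psi> \<notin> C"
    \<comment> \<open>The open complement of \<open>C\<close> would be a neighbourhood of \<psi>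
      that the sequence eventually avoids.\<close>
    then have "\<forall>\<^sub>F f in nhds \<psi>. f \<in> - C"
      by (intro eventually_nhds_in_open) auto
    moreover have "\<forall>\<^sub>F f in filtermap \<phi> sequentially. f \<in> C"
      using C by (simp add: eventually_filtermap)
    ultimately have "\<forall>\<^sub>F f in inf (nhds \<psi>) (filtermap \<phi> sequentially). False"
      unfolding eventually_inf by fastforce
    with \<psi> show False by (simp add: trivial_limit_def)
  qed
qed

lemma coord_norm_le: "cmod (coord f x) \<le> norm f"
proof -
  have "(cmod (coord f x))\<^sup>2 = (\<Sum>\<^sub>\<infinity>y\<in>{x}. (cmod (coord f y))\<^sup>2)"
    by simp
  also have "\<dots> \<le> (\<Sum>\<^sub>\<infinity>y. (cmod (coord f y))\<^sup>2)"
    by (rule infsum_mono_neutral) (auto intro: coord_square_summable)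
  finally show ?thesis
    unfolding norm_ell2_def by (rule real_le_rsqrt)
qed

lemma norm_ket: "norm (ket x) = 1"
proof -
  have "(\<Sum>\<^sub>\<infinity>y. (cmod (coord (ket x) y))\<^sup>2) = (\<Sum>\<^sub>\<infinity>y\<in>{x}. 1)"
    by (rule infsum_cong_neutral) (auto simp: ket.rep_eq)
  then show ?thesis by (simp add: norm_ell2_def)
qed

lemma cinner_ket: "cinner f (ket x) = cnj (coord f x)"
proof -
  have "cinner f (ket x) = (\<Sum>\<^sub>\<infinity>y\<in>{x}. cnj (coord f y))"
    unfolding cinner.rep_eq by (rule infsum_cong_neutral) (auto simp: ket.rep_eq)
  then show ?thesis by simp
qed

text \<open>Pairing with the basis vectors \<open>ket x\<close> recovers every coordinate of
  \<open>S f\<close>.\<close>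

lemma is_adjoint_unique:
  assumes "is_adjoint S T" "is_adjoint S' T"
  shows "S = S'"
proof (intro blinfun_eqI ell2_eqI)
  fix f x
  have "cinner (blinfun_apply S f) (ket x) = cinner (blinfun_apply S' f) (ket x)"
    using assms by (simp add: is_adjoint_def)
  then show "coord (blinfun_apply S f) x = coord (blinfun_apply S' f) x"
    by (simp add: cinner_ket)
qed

definition diagonal_entry :: "'i \<Rightarrow> 'i op \<Rightarrow> complex" where
  "diagonal_entry x T = coord (blinfun_apply T (ket x)) x"

lemma diagonal_entry_add: "diagonal_entry x (S + T) = diagonal_entry x S + diagonal_entry x T"
  by (simp add: diagonal_entry_def plus_blinfun.rep_eq plus_ell2.rep_eq)

lemma diagonal_entry_scaleC: "diagonal_entry x (scaleC_op c T) = c * diagonal_entry x T"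
  by (simp add: diagonal_entry_def scaleC_op_apply scaleC.rep_eq)

lemma diagonal_entry_norm_le: "cmod (diagonal_entry x T) \<le> norm T"
  unfolding diagonal_entry_def
  using order_trans[OF coord_norm_le norm_blinfun] by (metis norm_ket mult.right_neutral)

lemma bounded_functional_diagonal_entry: "bounded_functional A (diagonal_entry x)"
  unfolding bounded_functional_def
  by (auto simp: diagonal_entry_add diagonal_entry_scaleC diagonal_entry_norm_le intro: exI[of _ 1])

text \<open>Additivity, homogeneity and the norm bound at fixed arguments are closed conditions for
  pointwise convergence, so they pass from the diagonal entries to the cluster point. So does an
  eventually constant value.\<close>

lemma diagonal_entry_cluster_point:
  fixes x :: "nat \<Rightarrow> 'i"
  obtains \<psi> where "bounded_functional A \<psi>"
    and "\<And>T c. \<forall>\<^sub>F n in sequentially. diagonal_entry (x n) T = c \<Longrightarrow> \<psi> T = c"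
proof -
  have "bounded (range (\<lambda>n. diagonal_entry (x n) T))" for T
    unfolding bounded_iff by (auto simp: diagonal_entry_norm_le intro: exI[of _ "norm T"])
  then obtain \<psi> where \<psi>: "\<And>C. closed C \<Longrightarrow>
      \<forall>\<^sub>F n in sequentially. diagonal_entry (x n) \<in> C \<Longrightarrow> \<psi> \<in> C"
    using pointwise_bounded_cluster_point[of "\<lambda>n. diagonal_entry (x n)"] by metis
  have "\<psi> \<in> {f. f (S + T) = f S + f T}" for S T
    by (rule \<psi>) (auto intro!: closed_Collect_eq continuous_intros simp: diagonal_entry_add)
  moreover have "\<psi> \<in> {f. f (scaleC_op c T) = c * f T}" for c T
    by (rule \<psi>) (auto intro!: closed_Collect_eq continuous_intros simp: diagonal_entry_scaleC)
  moreover have "\<psi> \<in> {f. cmod (f T) \<le> norm T}" for T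
    by (rule \<psi>) (auto intro!: closed_Collect_le continuous_intros simp: diagonal_entry_norm_le)
  ultimately have "bounded_functional A \<psi>"
    unfolding bounded_functional_def by (auto intro: exI[of _ 1])
  moreover have "\<psi> T = c" if "\<forall>\<^sub>F n in sequentially. diagonal_entry (x n) T = c" for T c
  proof -
    have "\<psi> \<in> {f. f T = c}"
      by (rule \<psi>) (auto intro!: closed_Collect_eq continuous_intros simp: that)
    then show ?thesis by simp
  qed
  ultimately show ?thesis by (rule that)
qed

definition tail_projection :: "int \<Rightarrow> mono_index op" where
  "tail_projection k = annihilation k o\<^sub>L creation k"

text \<open>Annihilation undoes creation, so all that remains is the condition that \<open>k\<close>
  can be prepended.\<close>

lemma coord_tail_projection:
  "coord (blinfun_apply (tail_projection k) f) x = (if precedes k x then coord f x else 0)"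
  by (simp add: tail_projection_def coord_annihilation coord_creation
      starts_with_prepend tail_prepend)

lemma monotone_shift_tail_projection:
  "monotone_shift (tail_projection k) = tail_projection (k + 1)"
  by (intro blinfun_eqI ell2_eqI)
    (simp add: monotone_shift_def coord_translation coord_tail_projection precedes_translate)

lemma monotone_shift_funpow_tail_projection:
  "(monotone_shift ^^ n) (tail_projection k) = tail_projection (k + int n)"
  by (induction n) (simp_all add: monotone_shift_tail_projection algebra_simps)

lemma tail_projection_in_algebra: "tail_projection k \<in> monotone_cstar_algebra"
  unfolding monotone_cstar_algebra_def generated_unital_cstar_algebra_def
proof clarify
  fix A :: "mono_index op set"
  assume A: "unital_cstar_algebra A" "range annihilation \<subseteq> A"
  then have "annihilation k \<in> A" by blast
  moreover from this A obtain S where "S \<in> A" "is_adjoint S (annihilation k)"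
    unfolding unital_cstar_algebra_def by blast
  then have "creation k \<in> A"
    \<comment> \<open>Closure under adjoints yields only some adjoint \<open>S\<close>; uniqueness
      identifies it with \<open>creation k\<close>.\<close>
    using is_adjoint_unique creation_adjoint by metis
  ultimately show "tail_projection k \<in> A"
    using A unfolding tail_projection_def unital_cstar_algebra_def by blast
qed

abbreviation singleton_index :: "int \<Rightarrow> mono_index" where
  "singleton_index j \<equiv> prepend j empty_index"

lemma precedes_singleton: "precedes k (singleton_index j) \<longleftrightarrow> k < j"
  by transfer simp

lemma diagonal_entry_tail_projection:
  "diagonal_entry (singleton_index j) (tail_projection k) = (if k < j then 1 else 0)"
  by (simp add: diagonal_entry_def coord_tail_projection precedes_singleton ket.rep_eq)

theorem mainTheorem3:
  shows "\<not> uniquely_ergodic_wrt_fixed_points monotone_cstar_algebra monotone_shift"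
proof
  assume "uniquely_ergodic_wrt_fixed_points monotone_cstar_algebra monotone_shift"
  then obtain E where E: "(\<lambda>n. (\<Sum>k<n. \<phi> ((monotone_shift ^^ k) T)) / of_nat n) \<longlonglongrightarrow> \<phi> (E T)"
    if "T \<in> monotone_cstar_algebra" "bounded_functional monotone_cstar_algebra \<phi>" for T \<phi>
    unfolding uniquely_ergodic_wrt_fixed_points_def by blast
  define X where "X = E (tail_projection 0)"
  have X: "(\<lambda>n. (\<Sum>k<n. \<phi> (tail_projection (int k))) / of_nat n) \<longlonglongrightarrow> \<phi> X"
    if "bounded_functional monotone_cstar_algebra \<phi>" for \<phi>
    using E[OF tail_projection_in_algebra that, of 0]
    by (simp add: X_def monotone_shift_funpow_tail_projection)
  have zero: "diagonal_entry (singleton_index (int j)) X = 0" for j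
  proof -
    let ?\<phi> = "diagonal_entry (singleton_index (int j))"
    \<comment> \<open>Exactly the \<open>j\<close> terms with \<open>k < j\<close> equal 1, so the
      sums stop growing and the averages are eventually \<open>j / n\<close>.\<close>
    have "(\<Sum>k<n. ?\<phi> (tail_projection (int k))) = of_nat j" if "j \<le> n" for n
    proof -
      have "(\<Sum>k<n. ?\<phi> (tail_projection (int k))) = (\<Sum>k<j. 1)"
        using that by (intro sum.mono_neutral_cong_right) (auto simp: diagonal_entry_tail_projection)
      then show ?thesis by simp
    qed
    then have "\<forall>\<^sub>F n in sequentially.
        of_nat j / of_nat n = (\<Sum>k<n. ?\<phi> (tail_projection (int k))) / of_nat n"
      by (intro eventually_sequentiallyI[of j]) simp
    then have "(\<lambda>n. (\<Sum>k<n. ?\<phi> (tail_projection (int k))) / of_nat n) \<longlonglongrightarrow> 0"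
      by (rule Lim_transform_eventually[OF lim_const_over_n])
    then show ?thesis
      using LIMSEQ_unique X[OF bounded_functional_diagonal_entry] by blast
  qed
  obtain \<psi> where \<psi>: "bounded_functional monotone_cstar_algebra \<psi>"
    and limit: "\<And>T c. \<forall>\<^sub>F j in sequentially. diagonal_entry (singleton_index (int j)) T = c \<Longrightarrow> \<psi> T = c"
    using diagonal_entry_cluster_point[where x = "\<lambda>j. singleton_index (int j)"] by metis
  \<comment> \<open>For fixed \<open>k\<close>, the diagonal entry is 1 as soon as
    \<open>j > k\<close>.\<close>
  have "\<psi> (tail_projection (int k)) = 1" for k
    by (rule limit) (auto simp: diagonal_entry_tail_projection intro: eventually_gt_at_top)
  then have "(\<lambda>n. of_nat n / of_nat n :: complex) \<longlonglongrightarrow> \<psi> X"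
    using X[OF \<psi>] by simp
  moreover have "(\<lambda>n. of_nat n / of_nat n :: complex) \<longlonglongrightarrow> 1"
    \<comment> \<open>At \<open>n = 0\<close> the quotient is 0 by convention; it equals 1 from
      \<open>n = 1\<close> on.\<close>
    by (rule tendsto_eventually) (auto intro: eventually_sequentiallyI[of 1])
  ultimately have "\<psi> X = 1"
    by (rule LIMSEQ_unique)
  moreover have "\<psi> X = 0"
    by (rule limit) (simp add: zero)
  ultimately show False by simp
qed

end
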